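(* Let $\varphi$ be the Laplace transform of a probability distribution on $[0,\infty)$ and let $f$ be a characteristic function on $\mathbf{R}$. Then $f$ is $\varphi$-ID if and only if there is a function $\psi:\mathbf{R}\to\mathbf{C}$ such that $\omega(t)=e^{-\psi(t)}$ is an infinitely divisible characteristic function and $f(t)=\varphi\{\psi(t)\}$ for all $t\in\mathbf{R}$.
   Context: $\varphi(s)=E(e^{-sU})$ for a non-negative random variable $U$, used for all complex $s$ with $\operatorname{Re}s\ge 0$. A characteristic function $f$ is called $\varphi$-ID if there are positive constants $a_n$ and characteristic functions $f_n$ ($n\ge1$) such that $f(t)=\lim_{n\to\infty}\varphi\{a_n(1-f_n(t))\}$ for all $t\in\mathbf{R}$. (Here $\varphi\{a_n(1-s)\}$ is the probability generating function of a random variable $N_n$, and $\varphi\{a_n(1-f_n(t))\}$ is the characteristic function of a sum of $N_n$ i.i.d. random variables with characteristic function $f_n$, independent of $N_n$.) When $\omega=e^{-\psi}$ is an infinitely divisible characteristic function (which has no real zeros), $\psi=-\log\omega$ is the continuous branch with $\psi(0)=0$. *)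

theory Defs
  imports "HOL-Probability.Probability"
begin

definition characteristic_function :: "(real \<Rightarrow> complex) \<Rightarrow> bool" where
  "characteristic_function f \<longleftrightarrow> (\<exists>M. real_distribution M \<and> f = char M)"

definition infinitely_divisible_cf :: "(real \<Rightarrow> complex) \<Rightarrow> bool" where
  "infinitely_divisible_cf \<omega> \<longleftrightarrow> characteristic_function \<omega> \<and>
     (\<forall>n\<ge>1. \<exists>g. characteristic_function g \<and> (\<forall>t. \<omega> t = g t ^ n))"

text \<open>
  The transform is only meaningful for \<open>Re s \<ge> 0\<close>, where the integrand is bounded on
  the half-line carrying \<open>M\<close>; elsewhere the integral may fail to exist and is then \<open>0\<close>.
\<close>

definition laplace_transform :: "real measure \<Rightarrow> complex \<Rightarrow> complex" where
  "laplace_transform M s = (\<integral>u. exp (- (s * complex_of_real u)) \<partial>M)"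

text \<open>
  Since \<open>a n > 0\<close> and \<open>norm (g n t) \<le> 1\<close>, the function \<open>\<phi>\<close> is evaluated only in the closed
  right half-plane.
\<close>

definition phi_ID :: "(complex \<Rightarrow> complex) \<Rightarrow> (real \<Rightarrow> complex) \<Rightarrow> bool" where
  "phi_ID \<phi> f \<longleftrightarrow> characteristic_function f \<and>
     (\<exists>(a :: nat \<Rightarrow> real) (g :: nat \<Rightarrow> real \<Rightarrow> complex).
        (\<forall>n\<ge>1. a n > 0 \<and> characteristic_function (g n)) \<and>
        (\<forall>t. (\<lambda>n. \<phi> (complex_of_real (a n) * (1 - g n t))) \<longlonglongrightarrow> f t))"

end

theory Submission
  imports Defs "HOL-Complex_Analysis.Great_Picard"
begin

text \<open>
  Put \<open>h n = a n * (1 - g n)\<close>, so that \<open>exp (- c * h n)\<close> is a compound Poisson characteristic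
  function for every \<open>c \<ge> 0\<close>, and let \<open>\<phi>\<close> be the Laplace transform of a law that is not
  concentrated at 0. Since \<open>\<phi> \<circ> h n\<close> is a mixture of characteristic functions converging to
  the characteristic function \<open>f\<close>, it is uniformly close to 1 near the origin. As \<open>\<phi>\<close> stays
  away from 1 on small half-circles around 0 in the right half-plane and \<open>h n 0 = 0\<close>, the continuous curves \<open>h n\<close>
  cannot cross such a half-circle, so they are equicontinuous at 0. The increments of \<open>h n\<close> are
  controlled by its values near 0, hence a subsequence converges pointwise to a continuous \<open>\<psi>\<close>;
  each \<open>exp (- c * \<psi>)\<close> is then a characteristic function, which is infinite divisibility, and
  \<open>\<phi> (\<psi> t) = f t\<close>. Conversely, the \<open>n\<close>-th roots of \<open>exp (- \<psi>)\<close> are \<open>exp (- \<psi> / n)\<close>,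
  and \<open>n * (1 - exp (- \<psi> / n))\<close> tends to \<open>\<psi>\<close>.
\<close>

subsection \<open>Operations on characteristic functions\<close>

lemma integrable_pair_bounded:
  fixes F :: "'a \<times> 'b \<Rightarrow> 'c::{banach, second_countable_topology}"
  assumes "prob_space P" "prob_space Q" "F \<in> borel_measurable (P \<Otimes>\<^sub>M Q)" "\<And>z. norm (F z) \<le> B"
  shows "integrable (P \<Otimes>\<^sub>M Q) F"
proof -
  interpret pair_prob_space P Q
    using assms by (auto simp: pair_prob_space_def pair_sigma_finite_def prob_space_imp_sigma_finite)
  show ?thesis
    using assms by (intro integrable_const_bound[where B = B]) auto
qed

lemma Fubini_bounded:
  fixes F :: "'a \<Rightarrow> 'b \<Rightarrow> 'c::{banach, second_countable_topology}"
  assumes "prob_space P" "prob_space Q" "case_prod F \<in> borel_measurable (P \<Otimes>\<^sub>M Q)"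
    and "\<And>x y. norm (F x y) \<le> B"
  shows "(\<integral>x. (\<integral>y. F x y \<partial>Q) \<partial>P) = (\<integral>y. (\<integral>x. F x y \<partial>P) \<partial>Q)"
proof -
  interpret pair_prob_space P Q
    using assms by (auto simp: pair_prob_space_def pair_sigma_finite_def prob_space_imp_sigma_finite)
  show ?thesis
    using assms by (intro Fubini_integral[symmetric] integrable_pair_bounded[where B = B]) auto
qed

lemma cf_bounds:
  assumes "characteristic_function k"
  shows "k 0 = 1" "norm (k t) \<le> 1" "isCont k t" "k \<in> borel_measurable borel"
  using assms
  by (auto simp: characteristic_function_def real_distribution.char_zero
      real_distribution.cmod_char_le_1 real_distribution.isCont_char real_distribution.char_measurable)

text \<open>This is the transform of \<open>T (X, Y)\<close> for independent \<open>X\<close>,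
  \<open>Y\<close> with laws \<open>P\<close>, \<open>Q\<close>. A sum as \<open>T\<close> gives
  closure under products, and a product as \<open>T\<close> gives the Bernoulli mixture used for
  compound Poisson laws.\<close>

lemma cf_distr_pair:
  assumes "real_distribution P" "real_distribution Q"
    and T[measurable]: "T \<in> borel_measurable (borel \<Otimes>\<^sub>M borel)"
  shows "characteristic_function (\<lambda>t. \<integral>x. (\<integral>y. iexp (t * T (x, y)) \<partial>Q) \<partial>P)"
proof -
  interpret P: real_distribution P by fact
  interpret Q: real_distribution Q by fact
  interpret PQ: pair_prob_space P Q ..
  have T'[measurable]: "T \<in> borel_measurable (P \<Otimes>\<^sub>M Q)"
    by (subst measurable_cong_sets[OF sets_pair_measure_cong[OF P.events_eq_borel Q.events_eq_borel] refl]) (rule T)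
  have "char (distr (P \<Otimes>\<^sub>M Q) borel T) t = (\<integral>x. (\<integral>y. iexp (t * T (x, y)) \<partial>Q) \<partial>P)" for t
  proof -
    have "char (distr (P \<Otimes>\<^sub>M Q) borel T) t = (\<integral>z. iexp (t * T z) \<partial>(P \<Otimes>\<^sub>M Q))"
      by (simp add: char_def integral_distr)
    also have "\<dots> = (\<integral>x. (\<integral>y. iexp (t * T (x, y)) \<partial>Q) \<partial>P)"
      using PQ.integral_fst[of "\<lambda>x y. iexp (t * T (x, y))"]
        integrable_pair_bounded[OF P.prob_space_axioms Q.prob_space_axioms, of "\<lambda>z. iexp (t * T z)" 1]
      by (simp add: split_def)
    finally show ?thesis .
  qed
  then have "(\<lambda>t. \<integral>x. (\<integral>y. iexp (t * T (x, y)) \<partial>Q) \<partial>P) = char (distr (P \<Otimes>\<^sub>M Q) borel T)"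
    by auto
  moreover have "real_distribution (distr (P \<Otimes>\<^sub>M Q) borel T)"
    by (rule PQ.P.real_distribution_distr) simp
  ultimately show ?thesis
    unfolding characteristic_function_def by blast
qed

lemma cf_one: "characteristic_function (\<lambda>t. 1)"
proof -
  have "real_distribution (return borel (0::real))"
    by (auto simp: real_distribution_def real_distribution_axioms_def intro: prob_space_return)
  moreover have "char (return borel 0) = (\<lambda>t. 1)"
    by (auto simp: char_def integral_return)
  ultimately show ?thesis
    unfolding characteristic_function_def by metis
qed

lemma cf_mult:
  assumes "characteristic_function k" "characteristic_function l"
  shows "characteristic_function (\<lambda>t. k t * l t)"
proof -
  obtain P Q where P: "real_distribution P" "k = char P" and Q: "real_distribution Q" "l = char Q"
    using assms by (auto simp: characteristic_function_def)
  have "(\<integral>x. (\<integral>y. iexp (t * (fst (x, y) + snd (x, y))) \<partial>Q) \<partial>P) = k t * l t" for t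
    by (simp add: P Q char_def distrib_left exp_add)
  then show ?thesis
    using cf_distr_pair[OF P(1) Q(1), of "\<lambda>z. fst z + snd z"] by simp
qed

lemma cf_power:
  assumes "characteristic_function k"
  shows "characteristic_function (\<lambda>t. k t ^ n)"
  by (induction n) (simp_all add: cf_one cf_mult assms)

text \<open>If \<open>B\<close> is Bernoulli with parameter \<open>p\<close> and independent of
  \<open>Y\<close> with law \<open>Q\<close>, then \<open>B * Y\<close> has this transform:
  conditionally on \<open>B\<close> it is 1 or \<open>k t\<close>.\<close>

lemma cf_mixture:
  assumes k: "characteristic_function k" and p: "0 \<le> p" "p \<le> 1"
  shows "characteristic_function (\<lambda>t. 1 + of_real p * (k t - 1))"
proof -
  obtain Q where Q: "real_distribution Q" "k = char Q"
    using k by (auto simp: characteristic_function_def)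
  interpret Q: real_distribution Q by fact
  define P where "P = distr (measure_pmf (bernoulli_pmf p)) borel (\<lambda>b. of_bool b :: real)"
  have P: "real_distribution P"
    unfolding P_def by (rule prob_space.real_distribution_distr) (auto intro: prob_space_measure_pmf)
  have 1: "(\<integral>y. iexp (t * (fst (x, y) * snd (x, y))) \<partial>Q) = char Q (t * x)" for t x
    by (simp add: char_def mult_ac)
  have "(\<integral>x. char Q (t * x) \<partial>P) = 1 + of_real p * (k t - 1)" for t
    using p unfolding P_def by (subst integral_distr)
      (auto simp: Q integral_measure_pmf[of UNIV] UNIV_bool Q.char_zero scaleR_conv_of_real algebra_simps)
  then show ?thesis
    using cf_distr_pair[OF P Q(1), of "\<lambda>z. fst z * snd z"] 1 by simp
qed

subsection \<open>Gaussian means and the Levy continuity theorem\<close>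

text \<open>
  Averaging over a Gaussian is convenient because the kernel \<open>1 - cos\<close> turns into the explicit
  \<open>1 - exp (- (u * x)\<^sup>2 / 2)\<close>.
\<close>

definition gauss_mean :: "(real \<Rightarrow> complex) \<Rightarrow> real \<Rightarrow> real" where
  "gauss_mean k u = (\<integral>w. 1 - Re (k (u * w)) \<partial>std_normal_distribution)"

text \<open>Fubini moves the Gaussian average inside the integral over \<open>P\<close>, where it
  becomes the normal characteristic function at \<open>u * x\<close>.\<close>

lemma gauss_mean_char:
  assumes "real_distribution P"
  shows "gauss_mean (char P) u = (\<integral>x. 1 - exp (- ((u * x)\<^sup>2 / 2)) \<partial>P)"
proof -
  interpret P: real_distribution P by fact
  interpret N: real_distribution std_normal_distribution by (rule real_dist_normal_dist)
  have i: "integrable std_normal_distribution (\<lambda>w. char P (u * w))"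
    by (intro N.integrable_const_bound[where B = 1]) (auto simp: P.cmod_char_le_1)
  have "(\<integral>w. char P (u * w) \<partial>std_normal_distribution)
      = (\<integral>x. (\<integral>w. iexp (u * w * x) \<partial>std_normal_distribution) \<partial>P)"
    unfolding char_def
    by (rule Fubini_bounded[where B = 1]) (auto simp: N.prob_space_axioms P.prob_space_axioms)
  also have "\<dots> = (\<integral>x. char std_normal_distribution (u * x) \<partial>P)"
    unfolding char_def by (simp add: mult_ac)
  also have "\<dots> = of_real (\<integral>x. exp (- ((u * x)\<^sup>2 / 2)) \<partial>P)"
    by (simp add: char_std_normal_distribution del: of_real_exp)
  finally have "Re (\<integral>w. char P (u * w) \<partial>std_normal_distribution) = (\<integral>x. exp (- ((u * x)\<^sup>2 / 2)) \<partial>P)"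
    by simp
  moreover have "integrable P (\<lambda>x. exp (- ((u * x)\<^sup>2 / 2)))"
    by (intro P.integrable_const_bound[where B = 1]) auto
  ultimately show ?thesis
    using i by (simp add: gauss_mean_def P.prob_space[unfolded P.space_eq_univ] N.prob_space[unfolded N.space_eq_univ])
qed

lemma one_minus_exp_ge:
  fixes x :: real
  assumes "0 \<le> x"
  shows "x / (1 + x) \<le> 1 - exp (- x)"
proof -
  have "exp (- x) \<le> 1 / (1 + x)"
    using exp_ge_add_one_self[of x] assms by (simp add: exp_minus field_simps)
  moreover have "1 - 1 / (1 + x) = x / (1 + x)" using assms by (simp add: field_simps)
  ultimately show ?thesis by linarith
qed

text \<open>A Markov-type bound: off the interval \<open>(u * x)\<^sup>2\<close> is at least 1, so
  the kernel is at least (1/2) / (1 + 1/2) = 1/3. This is the source of the factor 3.\<close>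

lemma tail_le_gauss_mean:
  assumes "real_distribution P" "0 < u"
  shows "1 - 3 * gauss_mean (char P) u \<le> measure P {- (1 / u) <.. 1 / u}"
proof -
  interpret P: real_distribution P by fact
  let ?A = "{- (1 / u) <.. 1 / u}"
  have "1 - measure P ?A = measure P (- ?A)"
    using P.prob_compl[of ?A] by (simp add: Compl_eq_Diff_UNIV)
  also have "\<dots> = (\<integral>x. indicator (- ?A) x \<partial>P)" by simp
  also have "\<dots> \<le> (\<integral>x. 3 * (1 - exp (- ((u * x)\<^sup>2 / 2))) \<partial>P)"
  proof (rule integral_mono)
    show "integrable P (\<lambda>x. 3 * (1 - exp (- ((u * x)\<^sup>2 / 2))))"
      by (intro P.integrable_const_bound[where B = 3]) (auto simp: abs_mult)
    fix x
    have "1 \<le> 3 * (1 - exp (- ((u * x)\<^sup>2 / 2)))" if "x \<notin> ?A"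
    proof -
      have "1 \<le> \<bar>u * x\<bar>"
        using that \<open>0 < u\<close> by (auto simp: not_less not_le field_simps abs_if)
      then have "1 \<le> (u * x)\<^sup>2" by (metis power2_abs one_le_power)
      then have "1 / 3 \<le> ((u * x)\<^sup>2 / 2) / (1 + (u * x)\<^sup>2 / 2)"
        by (simp add: field_simps)
      also have "\<dots> \<le> 1 - exp (- ((u * x)\<^sup>2 / 2))" by (rule one_minus_exp_ge) simp
      finally show ?thesis by simp
    qed
    then show "indicator (- ?A) x \<le> 3 * (1 - exp (- ((u * x)\<^sup>2 / 2)))"
      by (auto simp: indicator_def)
  qed (auto simp: P.emeasure_eq_measure)
  also have "\<dots> = 3 * gauss_mean (char P) u"
    by (subst integral_mult_right_zero) (simp add: gauss_mean_char[OF assms(1)])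
  finally show ?thesis by simp
qed

lemma one_minus_cos_le: "1 - cos v \<le> v\<^sup>2 / 2" for v :: real
proof -
  have "1 - cos v = 2 * (sin (v / 2))\<^sup>2"
    using cos_double_sin[of "v / 2"] by simp
  also have "(sin (v / 2))\<^sup>2 \<le> (v / 2)\<^sup>2"
    using abs_sin_x_le_abs_x[of "v / 2"] by (subst abs_le_square_iff[symmetric]) simp
  finally show ?thesis by (simp add: power2_eq_square)
qed

text \<open>With \<open>v = (u * x)\<^sup>2\<close>, the left side is bounded by both
  \<open>v / 2\<close> and 2. The function \<open>3 * ((v / 2) / (1 + v / 2))\<close> dominates the
  first for \<open>v \<le> 4\<close> and the second beyond; all three are equal to 2 at
  \<open>v = 4\<close>.\<close>

lemma one_minus_cos_le_gauss:
  fixes t u x :: real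
  assumes "\<bar>t\<bar> \<le> u"
  shows "1 - cos (t * x) \<le> 3 * (1 - exp (- ((u * x)\<^sup>2 / 2)))"
proof -
  define v where "v = (u * x)\<^sup>2"
  have "v \<ge> 0" by (simp add: v_def)
  have "(t * x)\<^sup>2 \<le> v"
    unfolding v_def power_mult_distrib using assms abs_le_square_iff[of t u]
    by (intro mult_right_mono) auto
  then have 1: "1 - cos (t * x) \<le> v / 2" using one_minus_cos_le[of "t * x"] by simp
  have 2: "1 - cos (t * x) \<le> 2" using cos_ge_minus_one[of "t * x"] by linarith
  have "1 - cos (t * x) \<le> 3 * ((v / 2) / (1 + v / 2))"
  proof (cases "v \<le> 4")
    case True
    then have "v * (v * 2) \<le> v * 8" using \<open>v \<ge> 0\<close> by (intro mult_left_mono) auto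
    then have "v / 2 \<le> 3 * ((v / 2) / (1 + v / 2))"
      using \<open>v \<ge> 0\<close> by (simp add: field_simps)
    with 1 show ?thesis by linarith
  next
    case False
    then have "2 \<le> 3 * ((v / 2) / (1 + v / 2))" by (simp add: field_simps)
    with 2 show ?thesis by linarith
  qed
  then show ?thesis using one_minus_exp_ge[of "v / 2"] \<open>v \<ge> 0\<close> by (simp add: v_def)
qed

lemma Re_char:
  assumes "real_distribution P"
  shows "Re (char P t) = (\<integral>x. cos (t * x) \<partial>P)"
proof -
  interpret P: real_distribution P by fact
  have "integrable P (\<lambda>x. iexp (t * x))" by (intro P.integrable_iexp) auto
  then show ?thesis by (simp add: char_def Re_exp integral_Re[symmetric])
qed

text \<open>Integrating the kernel inequality over the law controls \<open>k\<close> on all of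
  [-u, u] by one number. Since that number passes to pointwise limits, pointwise convergence becomes
  uniform closeness to 1 near the origin.\<close>

lemma cf_le_gauss_mean:
  assumes "characteristic_function k" "\<bar>t\<bar> \<le> u"
  shows "1 - Re (k t) \<le> 3 * gauss_mean k u"
proof -
  obtain P where P: "real_distribution P" "k = char P"
    using assms by (auto simp: characteristic_function_def)
  interpret P: real_distribution P by fact
  have i: "integrable P (\<lambda>x. cos (t * x))"
    by (intro P.integrable_const_bound[where B = 1]) auto
  have "1 - Re (k t) = (\<integral>x. 1 - cos (t * x) \<partial>P)"
    using i by (simp add: P(2) Re_char[OF P(1)] P.prob_space[unfolded P.space_eq_univ])
  also have "\<dots> \<le> (\<integral>x. 3 * (1 - exp (- ((u * x)\<^sup>2 / 2))) \<partial>P)"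
  proof (rule integral_mono)
    show "integrable P (\<lambda>x. 1 - cos (t * x))" using i by simp
    show "integrable P (\<lambda>x. 3 * (1 - exp (- ((u * x)\<^sup>2 / 2))))"
      by (intro P.integrable_const_bound[where B = 3]) (auto simp: abs_mult)
  qed (rule one_minus_cos_le_gauss[OF assms(2)])
  also have "\<dots> = 3 * gauss_mean k u"
    by (subst integral_mult_right_zero) (simp add: P(2) gauss_mean_char[OF P(1)])
  finally show ?thesis .
qed

lemma gauss_mean_tendsto:
  assumes "\<And>n. k n \<in> borel_measurable borel" "\<And>n t. norm (k n t) \<le> 1"
    and "\<And>t. (\<lambda>n. k n t) \<longlonglongrightarrow> l t" "l \<in> borel_measurable borel"
  shows "(\<lambda>n. gauss_mean (k n) u) \<longlonglongrightarrow> gauss_mean l u"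
proof -
  interpret N: real_distribution std_normal_distribution by (rule real_dist_normal_dist)
  note assms(1,4)[measurable]
  show ?thesis
    unfolding gauss_mean_def
  proof (rule integral_dominated_convergence[where w = "\<lambda>_. 2"])
    have "norm (1 - Re (k n t)) \<le> 2" for n t
      using abs_Re_le_cmod[of "k n t"] assms(2)[of n t] by auto
    then show "AE x in std_normal_distribution. norm (1 - Re (k n (u * x))) \<le> 2" for n by simp
    show "AE x in std_normal_distribution. (\<lambda>n. 1 - Re (k n (u * x))) \<longlonglongrightarrow> 1 - Re (l (u * x))"
      using assms(3) by (auto intro!: tendsto_intros)
  qed auto
qed

text \<open>Scaling moves \<open>u\<close> into the argument of \<open>k\<close>; dominated
  convergence along \<open>u = 1 / Suc n\<close> then uses only continuity at 0.\<close>

lemma gauss_mean_small: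
  assumes "k \<in> borel_measurable borel" "\<And>t. norm (k t) \<le> 1" "isCont k 0" "k 0 = 1" "0 < \<epsilon>"
  obtains u where "0 < u" "gauss_mean k u < \<epsilon>"
proof -
  have "(\<lambda>n. k (1 / real (Suc n) * t)) \<longlonglongrightarrow> 1" for t
  proof -
    have "(\<lambda>n. inverse (real (Suc n)) * t) \<longlonglongrightarrow> 0 * t"
      by (intro tendsto_intros LIMSEQ_inverse_real_of_nat)
    then show ?thesis
      using isCont_tendsto_compose[OF assms(3)] assms(4) by (simp add: divide_inverse)
  qed
  then have "(\<lambda>n. gauss_mean (\<lambda>t. k (1 / real (Suc n) * t)) 1) \<longlonglongrightarrow> gauss_mean (\<lambda>_. 1) 1"
    by (intro gauss_mean_tendsto) (use assms in \<open>auto intro!: measurable_compose[OF _ assms(1)]\<close>)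
  then have "eventually (\<lambda>n. gauss_mean (\<lambda>t. k (1 / real (Suc n) * t)) 1 < \<epsilon>) sequentially"
    using assms(5) by (intro order_tendstoD(2)) (auto simp: gauss_mean_def)
  then obtain n where "gauss_mean (\<lambda>t. k (1 / real (Suc n) * t)) 1 < \<epsilon>"
    by (meson eventually_happens sequentially_bot)
  then show ?thesis
    by (intro that[of "1 / real (Suc n)"]) (auto simp: gauss_mean_def)
qed

section \<open>Tightness and the continuity theorem\<close>

lemma real_distribution_eventually_mass:
  assumes "real_distribution P" "0 < \<epsilon>"
  shows "eventually (\<lambda>K. 1 - \<epsilon> < measure P {- K <.. K}) at_top"
proof -
  interpret P: real_distribution P by fact
  have "((\<lambda>K. cdf P K - cdf P (- K)) \<longlongrightarrow> 1 - 0) at_top"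
    by (intro tendsto_diff P.cdf_lim_at_top_prob filterlim_compose[OF P.cdf_lim_at_bot filterlim_uminus_at_bot_at_top])
  then have "eventually (\<lambda>K. 1 - \<epsilon> < cdf P K - cdf P (- K)) at_top"
    using assms(2) by (intro order_tendstoD(1)) auto
  then show ?thesis
    using eventually_gt_at_top[of 0]
    by eventually_elim (auto simp: P.cdf_diff_eq)
qed

text \<open>Continuity of \<open>l\<close> at 0 makes its Gaussian mean small, hence also that of
  \<open>k n\<close> for large \<open>n\<close>, which bounds the tails. Tightness yields a weakly
  convergent subsequence, and the transform of its limit law must be \<open>l\<close>.\<close>

theorem cf_limit:
  assumes k: "\<And>n. characteristic_function (k n)" and lim: "\<And>t. (\<lambda>n. k n t) \<longlonglongrightarrow> l t"
    and cont: "isCont l 0" and meas: "l \<in> borel_measurable borel"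
  shows "characteristic_function l"
proof -
  obtain P where P: "\<And>n. real_distribution (P n)" "\<And>n. k n = char (P n)"
    using k unfolding characteristic_function_def by metis
  have norm_l: "norm (l t) \<le> 1" for t
    by (rule LIMSEQ_le_const2[OF tendsto_norm[OF lim]]) (auto simp: cf_bounds(2)[OF k])
  have l0: "l 0 = 1"
    using lim[of 0] by (simp add: cf_bounds(1)[OF k] LIMSEQ_const_iff)
  have "tight P"
    unfolding tight_def
  proof (intro conjI allI impI P(1))
    fix \<epsilon> :: real assume "0 < \<epsilon>"
    obtain u where u: "0 < u" "gauss_mean l u < \<epsilon> / 3"
      using gauss_mean_small[OF meas norm_l cont l0, of "\<epsilon> / 3"] \<open>0 < \<epsilon>\<close> by auto
    have "(\<lambda>n. gauss_mean (k n) u) \<longlonglongrightarrow> gauss_mean l u"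
      using cf_bounds[OF k] lim meas by (intro gauss_mean_tendsto) auto
    then have "eventually (\<lambda>n. gauss_mean (k n) u < \<epsilon> / 3) sequentially"
      using u(2) by (rule order_tendstoD)
    then obtain N where N: "\<And>n. n \<ge> N \<Longrightarrow> gauss_mean (k n) u < \<epsilon> / 3"
      by (auto simp: eventually_sequentially)
    \<comment> \<open>The Gaussian estimate covers only \<open>n \<ge> N\<close>. The finitely many
      earlier laws are handled by enlarging \<open>K\<close>; \<open>1 \<le> K\<close> makes the
      interval endpoints strictly ordered.\<close>
    have "eventually (\<lambda>K. \<forall>n\<in>{..<N}. 1 - \<epsilon> < measure (P n) {- K <.. K}) at_top"
      using real_distribution_eventually_mass[OF P(1) \<open>0 < \<epsilon>\<close>] by (intro eventually_ball_finite) auto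
    moreover have "eventually (\<lambda>K. max (1 / u) 1 \<le> K) at_top" by (rule eventually_ge_at_top)
    ultimately have "eventually (\<lambda>K. (\<forall>n\<in>{..<N}. 1 - \<epsilon> < measure (P n) {- K <.. K}) \<and> max (1 / u) 1 \<le> K) at_top"
      by (rule eventually_conj)
    then obtain K where K: "\<And>n. n < N \<Longrightarrow> 1 - \<epsilon> < measure (P n) {- K <.. K}" "1 / u \<le> K" "1 \<le> K"
      by (auto dest!: eventually_happens)
    have "1 - \<epsilon> < measure (P n) {- K <.. K}" for n
    proof (cases "n < N")
      case False
      interpret Pn: real_distribution "P n" by (rule P)
      have "1 - \<epsilon> < 1 - 3 * gauss_mean (k n) u" using N[of n] False by simp
      also have "\<dots> \<le> measure (P n) {- (1 / u) <.. 1 / u}"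
        unfolding P(2) by (rule tail_le_gauss_mean[OF P(1) u(1)])
      also have "\<dots> \<le> measure (P n) {- K <.. K}"
        using K(2) by (intro Pn.finite_measure_mono) auto
      finally show ?thesis .
    qed (rule K)
    then show "\<exists>a b. a < b \<and> (\<forall>n. 1 - \<epsilon> < measure (P n) {a<..b})"
      using K(3) by (intro exI[of _ "- K"] exI[of _ K]) auto
  qed
  then obtain r M where r: "strict_mono (r :: nat \<Rightarrow> nat)" "real_distribution M" "weak_conv_m (P \<circ> id \<circ> r) M"
    using tight_imp_convergent_subsubsequence[of P id] by (auto simp: strict_mono_def)
  have "char M t = l t" for t
  proof (rule LIMSEQ_unique)
    show "(\<lambda>n. char ((P \<circ> id \<circ> r) n) t) \<longlonglongrightarrow> char M t"
      using P r by (intro levy_continuity1) (auto simp: comp_def)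
    show "(\<lambda>n. char ((P \<circ> id \<circ> r) n) t) \<longlonglongrightarrow> l t"
      using LIMSEQ_subseq_LIMSEQ[OF lim r(1), of t] by (simp add: P(2) o_def)
  qed
  then have "char M = l" by auto
  then show ?thesis using r(2) unfolding characteristic_function_def by auto
qed

subsection \<open>Compound Poisson exponents\<close>

text \<open>With w = z / n, the power is \<open>exp (z * (Ln (1 + w) / w))\<close> once
  \<open>1 + w\<close> is nonzero, and the quotient tends to the derivative of
  \<open>Ln (1 + w)\<close> at 0, which is 1.\<close>

lemma complex_exp_limit:
  fixes z :: complex
  shows "(\<lambda>n. (1 + z / of_nat n) ^ n) \<longlonglongrightarrow> exp z"
proof (cases "z = 0")
  case False
  have "((\<lambda>w. Ln (1 + w) / w) \<longlongrightarrow> 1) (at 0)"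
  proof -
    have "((\<lambda>w. Ln (1 + w)) has_field_derivative 1) (at 0)"
      by (auto intro!: derivative_eq_intros)
    then show ?thesis by (simp add: has_field_derivative_iff)
  qed
  moreover have "filterlim (\<lambda>n. z / of_nat n) (at 0) sequentially"
    unfolding filterlim_at using False eventually_gt_at_top[of 0]
    by (auto intro!: lim_const_over_n elim!: eventually_mono)
  ultimately have "(\<lambda>n. Ln (1 + z / of_nat n) / (z / of_nat n)) \<longlonglongrightarrow> 1"
    by (rule filterlim_compose)
  then have "(\<lambda>n. exp (z * (Ln (1 + z / of_nat n) / (z / of_nat n)))) \<longlonglongrightarrow> exp (z * 1)"
    by (intro tendsto_intros)
  moreover have "eventually (\<lambda>n. exp (z * (Ln (1 + z / of_nat n) / (z / of_nat n))) = (1 + z / of_nat n) ^ n) sequentially"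
  proof -
    have "(\<lambda>n. 1 + z / of_nat n) \<longlonglongrightarrow> 1 + 0" by (intro tendsto_intros lim_const_over_n)
    then have "eventually (\<lambda>n. 1 + z / of_nat n \<noteq> 0) sequentially"
      by (intro tendsto_imp_eventually_ne) auto
    then show ?thesis
      using eventually_gt_at_top[of 0]
    proof eventually_elim
      case (elim n)
      have "z * (Ln (1 + z / of_nat n) / (z / of_nat n)) = of_nat n * Ln (1 + z / of_nat n)"
        using False elim by simp
      then show ?case using elim by (simp add: exp_of_nat_mult)
    qed
  qed
  ultimately show ?thesis by (simp add: tendsto_cong)
qed simp

text \<open>Poisson approximation: the function is the limit of \<open>n\<close>-th powers of
  Bernoulli mixtures with success probability \<open>a / n\<close>.\<close>

lemma cf_compound_Poisson:
  assumes g: "characteristic_function g" and a: "0 \<le> a"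
  shows "characteristic_function (\<lambda>t. exp (- (of_real a * (1 - g t))))"
proof -
  \<comment> \<open>Shifting the index by a positive \<open>m \<ge> a\<close> makes
    \<open>a / real (n + m)\<close> a probability for every \<open>n\<close>, including 0.\<close>
  obtain j where "a \<le> real j" using real_arch_simple by blast
  then obtain m where m: "a \<le> real m" "0 < m" by (intro that[of "Suc j"]) auto
  show ?thesis
  proof (rule cf_limit)
    fix n
    show "characteristic_function (\<lambda>t. (1 + of_real (a / real (n + m)) * (g t - 1)) ^ (n + m))"
      using m a by (intro cf_power cf_mixture g) (auto simp: field_simps)
  next
    fix t
    have "(\<lambda>n. (1 + of_real a * (g t - 1) / of_nat (n + m)) ^ (n + m)) \<longlonglongrightarrow> exp (of_real a * (g t - 1))"
      by (rule LIMSEQ_ignore_initial_segment[OF complex_exp_limit])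
    moreover have "of_real a * (g t - 1) = - (of_real a * (1 - g t))" by (simp add: right_diff_distrib)
    ultimately show "(\<lambda>n. (1 + of_real (a / real (n + m)) * (g t - 1)) ^ (n + m))
        \<longlonglongrightarrow> exp (- (of_real a * (1 - g t)))"
      by simp
  next
    show "isCont (\<lambda>t. exp (- (of_real a * (1 - g t)))) 0"
      using cf_bounds(3)[OF g] by (intro continuous_intros) auto
    note cf_bounds(4)[OF g, measurable]
    show "(\<lambda>t. exp (- (of_real a * (1 - g t)))) \<in> borel_measurable borel"
      by measurable
  qed
qed

section \<open>Increment inequalities for characteristic functions and Poisson exponents\<close>

lemma cf_Re_le_1: "characteristic_function k \<Longrightarrow> Re (k t) \<le> 1"
  using cf_bounds(2)[of k t] complex_Re_le_cmod[of "k t"] by linarith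

lemma norm_one_minus_iexp_sq: "(norm (1 - iexp x))\<^sup>2 = 2 * (1 - cos x)"
proof -
  have "(norm (1 - iexp x))\<^sup>2 = (1 - cos x)\<^sup>2 + (sin x)\<^sup>2"
    by (simp add: cmod_power2 Re_exp Im_exp)
  also have "\<dots> = 2 * (1 - cos x)"
    using sin_cos_squared_add3[of x] by (simp add: power2_eq_square algebra_simps)
  finally show ?thesis .
qed

text \<open>The product \<open>(1 - iexp (t * x)) * (1 - iexp (s * x))\<close> has mean
  \<open>1 - g t - g s + g (t + s)\<close>. Its norm is bounded by the weighted arithmetic-geometric
  mean inequality with weight \<open>c\<close>, and the squared norms of its factors are
  \<open>2 * (1 - cos _)\<close>.\<close>

lemma cf_increment:
  assumes g: "characteristic_function g" and "0 < c"
  shows "norm (g (t + s) - g t) \<le> norm (1 - g s) + c * (1 - Re (g t)) + (1 - Re (g s)) / c"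
proof -
  obtain P where P: "real_distribution P" "g = char P"
    using g by (auto simp: characteristic_function_def)
  interpret P: real_distribution P by fact
  have int_e[simp]: "integrable P (\<lambda>x. iexp (r * x))" for r by (intro P.integrable_iexp) auto
  have int_c[simp]: "integrable P (\<lambda>x. cos (r * x))" for r
    by (intro P.integrable_const_bound[where B = 1]) auto
  have id: "(1 - iexp (t * x)) * (1 - iexp (s * x)) = 1 - iexp (t * x) - iexp (s * x) + iexp ((t + s) * x)" for x
    by (simp add: algebra_simps exp_add)
  have bound: "norm ((1 - iexp (t * x)) * (1 - iexp (s * x))) \<le> c * (1 - cos (t * x)) + (1 - cos (s * x)) / c" for x
  proof -
    define p q where "p = norm (1 - iexp (t * x))" and "q = norm (1 - iexp (s * x))"
    have "0 \<le> (c * p - q)\<^sup>2" by simp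
    then have "p * q \<le> (c * p\<^sup>2 + q\<^sup>2 / c) / 2"
      using \<open>0 < c\<close> by (simp add: power2_eq_square field_simps)
    also have "\<dots> = c * (1 - cos (t * x)) + (1 - cos (s * x)) / c"
      unfolding p_def q_def norm_one_minus_iexp_sq using \<open>0 < c\<close> by (simp add: field_simps)
    finally show ?thesis by (simp add: p_def q_def norm_mult)
  qed
  have "1 - g t - g s + g (t + s) = (\<integral>x. (1 - iexp (t * x)) * (1 - iexp (s * x)) \<partial>P)"
    unfolding id P(2) char_def
    by (simp add: P.prob_space[unfolded P.space_eq_univ] del: of_real_mult of_real_add)
  also have "norm \<dots> \<le> (\<integral>x. norm ((1 - iexp (t * x)) * (1 - iexp (s * x))) \<partial>P)"
    by (rule integral_norm_bound)
  also have "\<dots> \<le> (\<integral>x. c * (1 - cos (t * x)) + (1 - cos (s * x)) / c \<partial>P)"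
  proof (rule integral_mono)
    show "integrable P (\<lambda>x. norm ((1 - iexp (t * x)) * (1 - iexp (s * x))))"
      unfolding id by (intro integrable_norm) (simp del: of_real_mult of_real_add)
  qed (auto intro: bound simp del: of_real_mult)
  also have "\<dots> = c * (1 - Re (g t)) + (1 - Re (g s)) / c"
    by (simp add: P(2) Re_char[OF P(1)] P.prob_space[unfolded P.space_eq_univ])
  finally have "norm (1 - g t - g s + g (t + s)) \<le> c * (1 - Re (g t)) + (1 - Re (g s)) / c" .
  moreover have "g (t + s) - g t = (1 - g t - g s + g (t + s)) - (1 - g s)" by simp
  ultimately show ?thesis
    using norm_triangle_ineq4[of "1 - g t - g s + g (t + s)" "1 - g s"] by (smt (verit))
qed

text \<open>The bound in \<open>cf_increment\<close> is homogeneous of degree one in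
  \<open>1 - g\<close>, so multiplying by \<open>a\<close> leaves only values of \<open>h\<close>.
  It is therefore uniform over a family of exponents however large the factors \<open>a\<close>
  are.\<close>

lemma Poisson_exponent_increment:
  assumes g: "characteristic_function g" and "0 < c" "0 \<le> a"
  defines "h \<equiv> \<lambda>t. of_real a * (1 - g t)"
  shows "norm (h (t + s) - h t) \<le> norm (h s) + c * Re (h t) + Re (h s) / c"
proof -
  have "norm (h (t + s) - h t) = a * norm (g (t + s) - g t)"
    using \<open>0 \<le> a\<close> unfolding h_def right_diff_distrib[symmetric] norm_mult
    by (simp add: norm_minus_commute)
  also have "\<dots> \<le> a * (norm (1 - g s) + c * (1 - Re (g t)) + (1 - Re (g s)) / c)"
    using \<open>0 \<le> a\<close> by (intro mult_left_mono cf_increment g \<open>0 < c\<close>)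
  also have "\<dots> = norm (h s) + c * Re (h t) + Re (h s) / c"
    using \<open>0 \<le> a\<close> unfolding h_def norm_mult by (simp add: algebra_simps)
  finally show ?thesis .
qed

text \<open>Take \<open>s = t\<close> and \<open>c = 1\<close> in the increment bound: three terms
  of size at most \<open>norm (h t)\<close>, and a fourth from the triangle inequality.\<close>

lemma Poisson_exponent_double:
  assumes g: "characteristic_function g" and "0 \<le> a"
  defines "h \<equiv> \<lambda>t. of_real a * (1 - g t)"
  shows "norm (h (2 * t)) \<le> 4 * norm (h t)"
proof -
  have "norm (h (t + t) - h t) \<le> norm (h t) + 1 * Re (h t) + Re (h t) / 1"
    unfolding h_def by (intro Poisson_exponent_increment assms) auto
  moreover have "Re (h t) \<le> norm (h t)" by (rule complex_Re_le_cmod)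
  moreover have "norm (h (2 * t)) \<le> norm (h (t + t) - h t) + norm (h t)"
    using norm_triangle_sub[of "h (t + t)" "h t"] by (simp only: mult_2 add.commute)
  ultimately show ?thesis by linarith
qed

subsection \<open>Laplace transforms on the right half-plane\<close>

lemma norm_one_minus_sq_le:
  fixes w :: complex
  assumes "norm w \<le> 1"
  shows "(norm (1 - w))\<^sup>2 \<le> 2 * (1 - Re w)"
proof -
  have "(norm (1 - w))\<^sup>2 = 1 - 2 * Re w + (norm w)\<^sup>2"
    unfolding cmod_power2 by (simp add: power2_eq_square algebra_simps)
  also have "\<dots> \<le> 1 - 2 * Re w + 1"
    using assms by (intro add_left_mono) (simp add: power_le_one)
  finally show ?thesis by simp
qed

locale nonneg_distribution = real_distribution +
  assumes nonneg: "AE u in M. 0 \<le> u"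
begin

text \<open>Truncating at 0 makes the integrand bounded everywhere, not only almost everywhere.\<close>

lemma laplace_transform_max:
  "laplace_transform M s = (\<integral>u. exp (- (s * of_real (max 0 u))) \<partial>M)"
  unfolding laplace_transform_def using nonneg by (intro integral_cong_AE) auto

lemma norm_exp_max_le: "0 \<le> Re s \<Longrightarrow> norm (exp (- (s * of_real (max 0 u)))) \<le> 1" for u :: real
  by (simp add: norm_exp)

lemma integrable_exp_max: "0 \<le> Re s \<Longrightarrow> integrable M (\<lambda>u. exp (- (s * of_real (max 0 u))))"
  using norm_exp_max_le by (intro integrable_const_bound[where B = 1]) auto

lemma norm_laplace_transform_le:
  assumes "0 \<le> Re s"
  shows "norm (laplace_transform M s) \<le> 1"
proof -
  have "norm (laplace_transform M s) \<le> (\<integral>u. norm (exp (- (s * of_real (max 0 u)))) \<partial>M)"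
    unfolding laplace_transform_max by (rule integral_norm_bound)
  also have "\<dots> \<le> 1"
    using assms norm_exp_max_le integrable_exp_max by (intro integral_le_const integrable_norm) auto
  finally show ?thesis .
qed

lemma laplace_transform_tendsto:
  assumes lim: "X \<longlonglongrightarrow> s" and Re: "\<And>n. 0 \<le> Re (X n)"
  shows "(\<lambda>n. laplace_transform M (X n)) \<longlonglongrightarrow> laplace_transform M s"
  unfolding laplace_transform_max
proof (rule integral_dominated_convergence[where w = "\<lambda>_. 1"])
  show "AE u in M. (\<lambda>n. exp (- (X n * of_real (max 0 u)))) \<longlonglongrightarrow> exp (- (s * of_real (max 0 u)))"
    by (intro always_eventually allI tendsto_intros lim)
qed (use Re norm_exp_max_le in auto)

lemma continuous_on_laplace_transform: "continuous_on {s. 0 \<le> Re s} (laplace_transform M)"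
  unfolding continuous_on_sequentially
proof safe
  fix X s assume "\<forall>n. X n \<in> {s. 0 \<le> Re s}" "X \<longlonglongrightarrow> s"
  then show "(laplace_transform M \<circ> X) \<longlonglongrightarrow> laplace_transform M s"
    using laplace_transform_tendsto[of X s] by (simp add: o_def)
qed

lemma one_minus_Re_laplace_transform:
  assumes "0 \<le> Re s"
  shows "1 - Re (laplace_transform M s) = (\<integral>u. 1 - Re (exp (- (s * of_real (max 0 u)))) \<partial>M)"
proof -
  note i = integrable_exp_max[OF assms]
  have "Re (laplace_transform M s) = (\<integral>u. Re (exp (- (s * of_real (max 0 u)))) \<partial>M)"
    unfolding laplace_transform_max by (rule integral_Re[OF i, symmetric])
  then show ?thesis
    by (subst Bochner_Integration.integral_diff)
      (auto intro!: integrable_Re i simp: prob_space[unfolded space_eq_univ] simp del: Re_exp uminus_complex.sel)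
qed

text \<open>A nonnegative integrand with zero integral vanishes almost everywhere. For
  \<open>u > 0\<close> a decaying exponential times a cosine can be 1 only if both factors are
  1.\<close>

lemma laplace_transform_eq_1_AE:
  assumes "0 \<le> Re s" "laplace_transform M s = 1"
  shows "AE u in M. 0 < u \<longrightarrow> Re s = 0 \<and> cos (Im s * u) = 1"
proof -
  let ?F = "\<lambda>u. 1 - Re (exp (- (s * of_real (max 0 u))))"
  have nn: "0 \<le> ?F u" for u
    using norm_exp_max_le[OF assms(1), of u] complex_Re_le_cmod[of "exp (- (s * of_real (max 0 u)))"] by linarith
  have "integrable M ?F"
    by (intro Bochner_Integration.integrable_diff integrable_Re integrable_exp_max assms) auto
  moreover have "(\<integral>u. ?F u \<partial>M) = 0"
    using one_minus_Re_laplace_transform[OF assms(1)] assms(2) by simp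
  ultimately have "AE u in M. ?F u = 0"
    using integral_nonneg_eq_0_iff_AE[of M ?F] nn by simp
  then show ?thesis
  proof eventually_elim
    case (elim u)
    show ?case
    proof
      assume "0 < u"
      then have eq: "exp (- (Re s * u)) * cos (Im s * u) = 1"
        using elim by (simp add: Re_exp)
      have le: "exp (- (Re s * u)) \<le> 1" using assms(1) \<open>0 < u\<close> by simp
      have "1 \<le> exp (- (Re s * u))"
        using eq mult_left_mono[of "cos (Im s * u)" 1 "exp (- (Re s * u))"] by simp
      with le have "exp (- (Re s * u)) = 1" by linarith
      then show "Re s = 0 \<and> cos (Im s * u) = 1" using eq \<open>0 < u\<close> by simp
    qed
  qed
qed

text \<open>Some interval (0, n] has positive mass. If the transform were 1 at \<open>s\<close>,
  then \<open>Re s = 0\<close> and \<open>cos (Im s * u) = 1\<close> for some \<open>u\<close> in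
  it; for \<open>norm s \<le> 1 / (n + 1)\<close> the angle is nonzero and at most 1, which is
  impossible. The statement is local because lattice laws return to 1 farther up the imaginary
  axis.\<close>

lemma laplace_transform_ne_1_near_0:
  assumes "\<not> (AE u in M. u = 0)"
  obtains r where "0 < r" "\<And>s. 0 \<le> Re s \<Longrightarrow> s \<noteq> 0 \<Longrightarrow> norm s \<le> r \<Longrightarrow> laplace_transform M s \<noteq> 1"
proof -
  have "\<exists>n::nat. \<not> (AE u in M. \<not> (0 < u \<and> u \<le> real n))"
  proof (rule ccontr)
    assume "\<not> ?thesis"
    then have "AE u in M. \<forall>n. \<not> (0 < u \<and> u \<le> real n)"
      by (subst AE_all_countable) auto
    then have "AE u in M. u = 0"
      using nonneg
    proof eventually_elim
      case (elim u)
      then show ?case using real_arch_simple[of u] by force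
    qed
    with assms show False by simp
  qed
  then obtain n :: nat where n: "\<not> (AE u in M. \<not> (0 < u \<and> u \<le> real n))" by blast
  show thesis
  proof (rule that[of "1 / (real n + 1)"])
    fix s assume s: "0 \<le> Re s" "s \<noteq> 0" "norm s \<le> 1 / (real n + 1)"
    show "laplace_transform M s \<noteq> 1"
    proof
      assume "laplace_transform M s = 1"
      from laplace_transform_eq_1_AE[OF s(1) this] have "AE u in M. \<not> (0 < u \<and> u \<le> real n)"
      proof eventually_elim
        case (elim u)
        show ?case
        proof
          assume u: "0 < u \<and> u \<le> real n"
          define v where "v = \<bar>Im s * u\<bar>"
          have "0 < v" using elim u s(2) by (auto simp: v_def complex_eq_iff)
          have "v \<le> norm s * (real n + 1)"
            unfolding v_def abs_mult using u by (intro mult_mono abs_Im_le_cmod) auto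
          also have "\<dots> \<le> 1" using s(3) by (simp add: field_simps)
          finally have "cos v < cos 0"
            using \<open>0 < v\<close> pi_gt3 by (intro cos_monotone_0_pi) auto
          then show False using elim u by (simp add: v_def)
        qed
      qed
      with n show False by simp
    qed
  qed auto
qed

text \<open>For each fixed \<open>x\<close> the function \<open>exp (- (h t * max 0 x))\<close> is a
  characteristic function, so \<open>cf_le_gauss_mean\<close> applies to it. Integrating over
  \<open>x\<close> and exchanging the integrals gives the same bound for the mixture.\<close>

lemma laplace_compose_le_gauss_mean:
  assumes h: "\<And>c. 0 \<le> c \<Longrightarrow> characteristic_function (\<lambda>t. exp (- (h t * of_real c)))"
    and meas[measurable]: "h \<in> borel_measurable borel" and Re: "\<And>t. 0 \<le> Re (h t)" and t: "\<bar>t\<bar> \<le> u"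
  shows "1 - Re (laplace_transform M (h t)) \<le> 3 * gauss_mean (\<lambda>t. laplace_transform M (h t)) u"
proof -
  interpret N: real_distribution std_normal_distribution by (rule real_dist_normal_dist)
  define F where "F = (\<lambda>w x. 1 - Re (exp (- (h (u * w) * of_real (max 0 x)))))"
  have F_bound: "norm (F w x) \<le> 2" for w x
    using norm_exp_max_le[OF Re, of "u * w" x] abs_Re_le_cmod[of "exp (- (h (u * w) * of_real (max 0 x)))"]
    unfolding F_def real_norm_def by linarith
  have F_meas[measurable]: "case_prod F \<in> borel_measurable (std_normal_distribution \<Otimes>\<^sub>M M)"
    unfolding F_def by measurable
  have "1 - Re (laplace_transform M (h t)) = (\<integral>x. 1 - Re (exp (- (h t * of_real (max 0 x)))) \<partial>M)"
    by (rule one_minus_Re_laplace_transform[OF Re])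
  also have "\<dots> \<le> (\<integral>x. 3 * (\<integral>w. F w x \<partial>std_normal_distribution) \<partial>M)"
  proof (rule integral_mono)
    show "integrable M (\<lambda>x. 1 - Re (exp (- (h t * of_real (max 0 x)))))"
      by (intro Bochner_Integration.integrable_diff integrable_Re integrable_exp_max Re) auto
    have "norm (\<integral>w. F w x \<partial>std_normal_distribution) \<le> 2" for x
    proof -
      have "norm (\<integral>w. F w x \<partial>std_normal_distribution) \<le> (\<integral>w. norm (F w x) \<partial>std_normal_distribution)"
        by (rule integral_norm_bound)
      also have "\<dots> \<le> 2"
        using F_bound by (intro N.integral_le_const N.integrable_const_bound[where B = 2]) (auto simp: F_def)
      finally show ?thesis .
    qed
    moreover have "(\<lambda>x. \<integral>w. F w x \<partial>std_normal_distribution) \<in> borel_measurable M"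
      unfolding F_def by measurable
    ultimately have "integrable M (\<lambda>x. \<integral>w. F w x \<partial>std_normal_distribution)"
      by (intro integrable_const_bound[where B = 2]) auto
    then show "integrable M (\<lambda>x. 3 * (\<integral>w. F w x \<partial>std_normal_distribution))" by simp
    fix x
    have "characteristic_function (\<lambda>t. exp (- (h t * of_real (max 0 x))))" by (intro h) auto
    from cf_le_gauss_mean[OF this t]
    show "1 - Re (exp (- (h t * of_real (max 0 x)))) \<le> 3 * (\<integral>w. F w x \<partial>std_normal_distribution)"
      by (simp only: gauss_mean_def F_def)
  qed
  also have "\<dots> = 3 * (\<integral>x. (\<integral>w. F w x \<partial>std_normal_distribution) \<partial>M)"
    by (rule integral_mult_right_zero)
  also have "(\<integral>x. (\<integral>w. F w x \<partial>std_normal_distribution) \<partial>M) = (\<integral>w. (\<integral>x. F w x \<partial>M) \<partial>std_normal_distribution)"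
    using F_bound F_meas
    by (intro Fubini_bounded[symmetric]) (auto simp: N.prob_space_axioms prob_space_axioms)
  also have "\<dots> = gauss_mean (\<lambda>t. laplace_transform M (h t)) u"
    unfolding gauss_mean_def F_def by (simp only: one_minus_Re_laplace_transform[OF Re])
  finally show ?thesis .
qed

text \<open>Closeness of the transform to 1 does not by itself bound \<open>h n t\<close>, since the
  transform can be 1 far from 0. Continuity of \<open>h n\<close> along the segment from 0 to
  \<open>t\<close> excludes this: a small half-circle acts as a barrier.\<close>

lemma exponents_equicontinuous_at_0:
  assumes h: "\<And>n c. 0 \<le> c \<Longrightarrow> characteristic_function (\<lambda>t. exp (- (h n t * of_real c)))"
    and cont: "\<And>n. continuous_on UNIV (h n)" and Re: "\<And>n t. 0 \<le> Re (h n t)" and h0: "\<And>n. h n 0 = 0"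
    and f: "characteristic_function f" and lim: "\<And>t. (\<lambda>n. laplace_transform M (h n t)) \<longlonglongrightarrow> f t"
    and nontrivial: "\<not> (AE u in M. u = 0)" and "0 < r"
  shows "\<exists>\<delta>>0. \<exists>N. \<forall>n\<ge>N. \<forall>t. \<bar>t\<bar> \<le> \<delta> \<longrightarrow> norm (h n t) < r"
proof -
  obtain r0 where r0: "0 < r0" "\<And>s. 0 \<le> Re s \<Longrightarrow> s \<noteq> 0 \<Longrightarrow> norm s \<le> r0 \<Longrightarrow> laplace_transform M s \<noteq> 1"
    using laplace_transform_ne_1_near_0[OF nontrivial] by blast
  \<comment> \<open>The radius is at most \<open>r\<close> for the desired bound and at most
    \<open>r0\<close> so that the transform differs from 1 on the half-circle \<open>K\<close>;
    compactness of \<open>K\<close> then yields a positive distance \<open>m\<close>.\<close>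
  define \<rho> where "\<rho> = min r r0"
  have \<rho>: "0 < \<rho>" "\<rho> \<le> r" "\<rho> \<le> r0" using \<open>0 < r\<close> r0(1) by (auto simp: \<rho>_def)
  define K where "K = sphere 0 \<rho> \<inter> {s. 0 \<le> Re s}"
  have "compact K"
    unfolding K_def by (intro compact_Int_closed compact_sphere closed_halfspace_Re_ge)
  moreover have "of_real \<rho> \<in> K" using \<rho> by (auto simp: K_def)
  moreover have "continuous_on K (\<lambda>s. norm (1 - laplace_transform M s))"
    by (intro continuous_intros continuous_on_subset[OF continuous_on_laplace_transform]) (auto simp: K_def)
  ultimately obtain s0 where s0: "s0 \<in> K"
      "\<And>s. s \<in> K \<Longrightarrow> norm (1 - laplace_transform M s0) \<le> norm (1 - laplace_transform M s)"
    using continuous_attains_inf[of K "\<lambda>s. norm (1 - laplace_transform M s)"] by blast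
  define m where "m = norm (1 - laplace_transform M s0)"
  have "0 < m" using s0(1) r0(2)[of s0] \<rho> by (auto simp: m_def K_def)
  let ?\<phi>h = "\<lambda>n t. laplace_transform M (h n t)"
  have h_meas: "h n \<in> borel_measurable borel" for n
    by (rule borel_measurable_continuous_onI[OF cont])
  have \<phi>h_meas: "?\<phi>h n \<in> borel_measurable borel" for n
    by (intro borel_measurable_continuous_onI continuous_on_compose2[OF continuous_on_laplace_transform cont])
      (auto simp: Re)
  \<comment> \<open>The 6 combines the factor 3 of the Gaussian bound with the factor 2 in
    \<open>norm_one_minus_sq_le\<close>, so the squared distance to 1 falls below
    \<open>m\<^sup>2\<close>.\<close>
  obtain u where u: "0 < u" "gauss_mean f u < m\<^sup>2 / 6"
    using gauss_mean_small[of f "m\<^sup>2 / 6"] cf_bounds[OF f] \<open>0 < m\<close> by auto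
  have "(\<lambda>n. gauss_mean (?\<phi>h n) u) \<longlonglongrightarrow> gauss_mean f u"
    using \<phi>h_meas norm_laplace_transform_le[OF Re] lim cf_bounds(4)[OF f] by (intro gauss_mean_tendsto) auto
  then have "eventually (\<lambda>n. gauss_mean (?\<phi>h n) u < m\<^sup>2 / 6) sequentially"
    using u(2) by (rule order_tendstoD)
  then obtain N where N: "\<And>n. n \<ge> N \<Longrightarrow> gauss_mean (?\<phi>h n) u < m\<^sup>2 / 6"
    by (auto simp: eventually_sequentially)
  have close: "norm (1 - ?\<phi>h n t) < m" if "n \<ge> N" "\<bar>t\<bar> \<le> u" for n t
  proof -
    have "(norm (1 - ?\<phi>h n t))\<^sup>2 \<le> 2 * (1 - Re (?\<phi>h n t))"
      by (intro norm_one_minus_sq_le norm_laplace_transform_le Re)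
    also have "\<dots> < m\<^sup>2"
      using laplace_compose_le_gauss_mean[OF h h_meas Re that(2), of n] N[OF that(1)] by simp
    finally show ?thesis using \<open>0 < m\<close> by (simp add: power_less_imp_less_base)
  qed
  \<comment> \<open>Otherwise the intermediate value theorem gives a point \<open>x * t\<close>
    where \<open>h n\<close> lies on \<open>K\<close>, at which the transform is at least
    \<open>m\<close> away from 1.\<close>
  have "norm (h n t) < r" if n: "n \<ge> N" and t: "\<bar>t\<bar> \<le> u" for n t
  proof (rule ccontr)
    assume "\<not> norm (h n t) < r"
    then have "\<rho> \<le> norm (h n (1 * t))" using \<rho> by simp
    moreover have "norm (h n (0 * t)) \<le> \<rho>" using h0 \<rho> by simp
    moreover have "continuous_on {0..1} (\<lambda>x. norm (h n (x * t)))"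
      by (intro continuous_on_norm continuous_on_compose2[OF cont] continuous_intros) auto
    ultimately obtain x where x: "0 \<le> x" "x \<le> 1" "norm (h n (x * t)) = \<rho>"
      using IVT'[of "\<lambda>x. norm (h n (x * t))" 0 \<rho> 1] by auto
    then have "m \<le> norm (1 - ?\<phi>h n (x * t))"
      unfolding m_def by (intro s0(2)) (auto simp: K_def Re)
    moreover have "\<bar>x * t\<bar> \<le> u"
      using x t mult_mono[of x 1 "\<bar>t\<bar>" u] by (simp add: abs_mult)
    ultimately show False using close[OF n, of "x * t"] by simp
  qed
  with u(1) show ?thesis by blast
qed

end

subsection \<open>Limits of exponents\<close>

lemma cf_exponent_scale:
  assumes "characteristic_function g" "0 \<le> a" "0 \<le> c"
  shows "characteristic_function (\<lambda>t. exp (- (of_real a * (1 - g t) * of_real c)))"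
  using cf_compound_Poisson[OF assms(1), of "a * c"] assms(2,3) by (simp add: mult_ac)

text \<open>The weight \<open>c\<close> is fixed first, to make \<open>c * Re y\<close> at most
  \<open>e / 4\<close>; only then can \<open>r\<close> be chosen to absorb the division by
  \<open>c\<close>. The three terms add up to at most \<open>3 * e / 4\<close>.\<close>

lemma increment_bound_small:
  assumes "0 < K" "0 < e"
  shows "\<exists>c>0. \<exists>r>0. \<forall>x y. norm x \<le> r \<longrightarrow> Re y \<le> K \<longrightarrow> norm x + c * Re y + Re x / c < e"
proof -
  define c where "c = e / (4 * K)"
  define r where "r = min (e / 4) (e * c / 4)"
  have c: "0 < c" using assms by (simp add: c_def)
  have "norm x + c * Re y + Re x / c < e" if x: "norm x \<le> r" and y: "Re y \<le> K" for x y
  proof -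
    have "c * Re y \<le> e / 4"
      using mult_left_mono[OF y, of c] c assms by (simp add: c_def)
    moreover have "Re x / c \<le> e / 4"
      using complex_Re_le_cmod[of x] x c by (simp add: r_def field_simps)
    moreover have "norm x \<le> e / 4" using x by (simp add: r_def)
    ultimately show ?thesis using assms by linarith
  qed
  moreover have "0 < r" using c assms by (simp add: r_def)
  ultimately show ?thesis using c by blast
qed

text \<open>Each doubling of the argument costs a factor 4, so the bound 1 near the origin spreads
  to \<open>4 ^ k\<close> on the interval enlarged by \<open>2 ^ k\<close>.\<close>

lemma Poisson_exponents_pointwise_bounded:
  assumes g: "\<And>n. characteristic_function (g n)" and a: "\<And>n. 0 \<le> a n"
  defines "h \<equiv> \<lambda>n t. of_real (a n) * (1 - g n t)"
  assumes "0 < \<delta>" and \<delta>: "\<And>n t. \<bar>t\<bar> \<le> \<delta> \<Longrightarrow> norm (h n t) \<le> 1"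
  shows "\<exists>K>0. \<forall>n. norm (h n t) \<le> K"
proof -
  have *: "norm (h n t) \<le> 4 ^ k" if "\<bar>t\<bar> \<le> 2 ^ k * \<delta>" for n k t
    using that
  proof (induction k arbitrary: t)
    case (Suc k)
    have "norm (h n (2 * (t / 2))) \<le> 4 * norm (h n (t / 2))"
      unfolding h_def by (intro Poisson_exponent_double g a)
    also have "norm (h n (t / 2)) \<le> 4 ^ k" using Suc by simp
    finally show ?case by simp
  qed (simp add: \<delta>)
  obtain k where "\<bar>t\<bar> / \<delta> < 2 ^ k" using real_arch_pow[of 2 "\<bar>t\<bar> / \<delta>"] by auto
  then have "\<bar>t\<bar> \<le> 2 ^ k * \<delta>" using \<open>0 < \<delta>\<close> by (simp add: field_simps)
  with * show ?thesis by (intro exI[of _ "4 ^ k"]) auto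
qed

text \<open>An Arzela-Ascoli argument: a diagonal subsequence converges at the rationals, and the
  increment inequality transports equicontinuity at 0 to every \<open>t\<close>, where
  \<open>Re (h n t)\<close> is bounded along the sequence.\<close>

lemma Poisson_exponents_convergent_subsequence:
  assumes g: "\<And>n. characteristic_function (g n)" and a: "\<And>n. 0 \<le> a n"
  defines "h \<equiv> \<lambda>n t. of_real (a n) * (1 - g n t)"
  assumes equi: "\<And>r. 0 < r \<Longrightarrow> \<exists>\<delta>>0. \<exists>N. \<forall>n\<ge>N. \<forall>t. \<bar>t\<bar> \<le> \<delta> \<longrightarrow> norm (h n t) < r"
  obtains k \<psi> where "strict_mono (k :: nat \<Rightarrow> nat)" "\<And>t. (\<lambda>n. h (k n) t) \<longlonglongrightarrow> \<psi> t" "continuous_on UNIV \<psi>"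
proof -
  obtain \<delta> N where N: "0 < \<delta>" "\<And>n t. n \<ge> N \<Longrightarrow> \<bar>t\<bar> \<le> \<delta> \<Longrightarrow> norm (h n t) < 1"
    using equi[of 1] by auto
  have "\<exists>K>0. \<forall>n. norm (h (n + N) t) \<le> K" for t
    unfolding h_def using g a N(1) less_imp_le[OF N(2)]
    by (intro Poisson_exponents_pointwise_bounded) (auto simp: h_def)
  then obtain K where K: "\<And>t. 0 < K t" "\<And>n t. norm (h (n + N) t) \<le> K t"
    by metis
  \<comment> \<open>The diagonal selection needs one bound for all points, hence the division by
    \<open>K t\<close>, which is undone afterwards. The shift by \<open>N\<close> skips the indices
    without control near 0.\<close>
  obtain j where j: "strict_mono (j :: nat \<Rightarrow> nat)"
      "\<And>t. t \<in> \<rat> \<Longrightarrow> \<exists>l. (\<lambda>n. h (j n + N) t / of_real (K t)) \<longlonglongrightarrow> l"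
  proof (rule function_convergent_subsequence[of \<rat> "\<lambda>n t. h (n + N) t / of_real (K t)" 1])
    show "norm (h (n + N) t / of_real (K t)) \<le> 1" for n t
      using K(1)[of t] K(2)[of n t] by (simp add: norm_divide)
  qed (auto intro: countable_rat)
  define k where "k n = j n + N" for n
  have k: "strict_mono k" using j(1) by (auto simp: k_def strict_mono_def)
  have k_ge: "n \<le> k n" "N \<le> k n" for n using seq_suble[OF j(1), of n] by (auto simp: k_def)
  have rat: "convergent (\<lambda>n. h (k n) t)" if "t \<in> \<rat>" for t
  proof -
    have "convergent (\<lambda>n. h (k n) t / of_real (K t))"
      using j(2)[OF that] by (simp add: k_def convergent_def)
    then have "convergent (\<lambda>n. h (k n) t / of_real (K t) * of_real (K t))"
      by (intro convergent_mult convergent_const)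
    then show ?thesis using K(1)[of t] by simp
  qed
  have inc: "norm (h n (t + s) - h n t) \<le> norm (h n s) + c * Re (h n t) + Re (h n s) / c"
    if "0 < c" for n t s c
    unfolding h_def by (intro Poisson_exponent_increment g a that)
  have "Cauchy (\<lambda>n. h (k n) t)" for t
  proof (rule metric_CauchyI)
    fix e :: real assume "0 < e"
    then have e3: "0 < e / 3" by simp
    obtain c r where c: "0 < c" "0 < r"
      "\<And>x y :: complex. norm x \<le> r \<Longrightarrow> Re y \<le> K t \<Longrightarrow> norm x + c * Re y + Re x / c < e / 3"
      using increment_bound_small[OF K(1)[of t] e3] by blast
    obtain \<eta> N1 where \<eta>: "0 < \<eta>" "\<And>n s. n \<ge> N1 \<Longrightarrow> \<bar>s\<bar> \<le> \<eta> \<Longrightarrow> norm (h n s) < r"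
      using equi[OF c(2)] by auto
    \<comment> \<open>A rational within \<open>\<eta>\<close> of \<open>t\<close> permits the
      three-term Cauchy estimate, with \<open>h (k n) q\<close> convergent in the middle.\<close>
    obtain q where q: "q \<in> \<rat>" "t < q" "q < t + \<eta>"
      using Rats_dense_in_real[of t "t + \<eta>"] \<eta>(1) by auto
    have near: "dist (h (k n) q) (h (k n) t) < e / 3" if "n \<ge> N1" for n
    proof -
      have "norm (h (k n) (t + (q - t)) - h (k n) t)
          \<le> norm (h (k n) (q - t)) + c * Re (h (k n) t) + Re (h (k n) (q - t)) / c"
        by (rule inc[OF c(1)])
      also have "\<dots> < e / 3"
      proof (rule c(3))
        show "norm (h (k n) (q - t)) \<le> r"
          using \<eta>(2)[of "k n" "q - t"] k_ge(1)[of n] that q by auto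
        show "Re (h (k n) t) \<le> K t"
          using K(2)[of "j n" t] complex_Re_le_cmod[of "h (k n) t"] by (simp add: k_def)
      qed
      finally show ?thesis by (simp add: dist_norm)
    qed
    obtain N2 where N2: "\<And>m n. m \<ge> N2 \<Longrightarrow> n \<ge> N2 \<Longrightarrow> dist (h (k m) q) (h (k n) q) < e / 3"
      using metric_CauchyD[OF convergent_Cauchy[OF rat[OF q(1)]], of "e / 3"] \<open>0 < e\<close> by auto
    have "dist (h (k m) t) (h (k n) t) < e" if "m \<ge> max N1 N2" "n \<ge> max N1 N2" for m n
      using near[of m] near[of n] N2[of m n] that
        dist_triangle[of "h (k m) t" "h (k n) t" "h (k m) q"]
        dist_triangle[of "h (k m) q" "h (k n) t" "h (k n) q"]
      by (auto simp: dist_commute)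
    then show "\<exists>M. \<forall>m\<ge>M. \<forall>n\<ge>M. dist (h (k m) t) (h (k n) t) < e" by blast
  qed
  then have "\<exists>l. (\<lambda>n. h (k n) t) \<longlonglongrightarrow> l" for t
    by (simp add: Cauchy_convergent_iff convergent_def)
  then obtain \<psi> where \<psi>: "\<And>t. (\<lambda>n. h (k n) t) \<longlonglongrightarrow> \<psi> t"
    by metis
  have inc_\<psi>: "norm (\<psi> (t + s) - \<psi> t) \<le> norm (\<psi> s) + c * Re (\<psi> t) + Re (\<psi> s) / c" if "0 < c" for t s c
  proof (rule LIMSEQ_le)
    show "(\<lambda>n. norm (h (k n) (t + s) - h (k n) t)) \<longlonglongrightarrow> norm (\<psi> (t + s) - \<psi> t)"
      by (intro tendsto_intros \<psi>)
    show "(\<lambda>n. norm (h (k n) s) + c * Re (h (k n) t) + Re (h (k n) s) / c)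
        \<longlonglongrightarrow> norm (\<psi> s) + c * Re (\<psi> t) + Re (\<psi> s) / c"
      using that by (intro tendsto_intros \<psi>) auto
  qed (use inc[OF that] in auto)
  have "isCont \<psi> t" for t
    unfolding continuous_at_eps_delta
  proof (intro allI impI)
    fix e :: real assume "0 < e"
    \<comment> \<open>\<open>Re (\<psi> t)\<close> may be 0, whereas the choice of \<open>c\<close>
      requires a positive bound.\<close>
    have "0 < max 1 (Re (\<psi> t))" by simp
    obtain c r where c: "0 < c" "0 < r"
      "\<And>x y. norm x \<le> r \<Longrightarrow> Re y \<le> max 1 (Re (\<psi> t)) \<Longrightarrow> norm x + c * Re y + Re x / c < e"
      using increment_bound_small[OF \<open>0 < max 1 (Re (\<psi> t))\<close> \<open>0 < e\<close>] by blast
    obtain \<eta> N1 where \<eta>: "0 < \<eta>" "\<And>n s. n \<ge> N1 \<Longrightarrow> \<bar>s\<bar> \<le> \<eta> \<Longrightarrow> norm (h n s) < r"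
      using equi[OF c(2)] by auto
    have "dist (\<psi> x) (\<psi> t) < e" if "dist x t < \<eta>" for x
    proof -
      have "norm (h (k n) (x - t)) \<le> r" if "n \<ge> N1" for n
        using \<eta>(2)[of "k n" "x - t"] k_ge(1)[of n] that \<open>dist x t < \<eta>\<close> by (simp add: dist_real_def)
      then have "norm (\<psi> (x - t)) \<le> r"
        by (intro LIMSEQ_le_const2[OF tendsto_norm[OF \<psi>]]) blast
      then show ?thesis
        using inc_\<psi>[OF c(1), of t "x - t"] c(3)[of "\<psi> (x - t)" "\<psi> t"] by (simp add: dist_norm)
    qed
    with \<eta>(1) show "\<exists>d>0. \<forall>x. dist x t < d \<longrightarrow> dist (\<psi> x) (\<psi> t) < e" by blast
  qed
  then have "continuous_on UNIV \<psi>" by (simp add: continuous_on_eq_continuous_at)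
  with k \<psi> show thesis by (rule that)
qed

text \<open>The quotient of the two candidate roots is continuous and takes values in the finite set
  of \<open>n\<close>-th roots of unity, so it is constant; at 0 it is 1.\<close>

lemma cf_nth_root_eq_exp:
  assumes g: "characteristic_function g" and root: "\<And>t. exp (- \<psi> t) = g t ^ n" and "0 < n"
    and cont: "continuous_on UNIV \<psi>" and "\<psi> 0 = 0"
  shows "g t = exp (- (\<psi> t / of_nat n))"
proof -
  define q where "q t = g t * exp (\<psi> t / of_nat n)" for t
  have "q t ^ n = 1" for t
  proof -
    have "q t ^ n = exp (- \<psi> t) * exp (of_nat n * (\<psi> t / of_nat n))"
      unfolding q_def power_mult_distrib root exp_of_nat_mult ..
    then show ?thesis using \<open>0 < n\<close> by (simp flip: exp_add)
  qed
  then have "range q \<subseteq> {z. z ^ n = 1}" by auto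
  then have "finite (range q)"
    by (rule finite_subset) (use \<open>0 < n\<close> in \<open>auto intro!: finite_roots_unity\<close>)
  moreover have "continuous_on UNIV q"
    unfolding q_def using cf_bounds(3)[OF g]
    by (intro continuous_intros cont) (auto simp: continuous_on_eq_continuous_at \<open>0 < n\<close>)
  ultimately have "q constant_on UNIV"
    by (intro continuous_finite_range_constant) auto
  then have "q t = q 0" by (auto simp: constant_on_def)
  also have "q 0 = 1" using \<open>\<psi> 0 = 0\<close> by (simp add: q_def cf_bounds(1)[OF g])
  finally show ?thesis by (simp add: q_def exp_minus field_simps)
qed

text \<open>With w = z / n this is \<open>z\<close> times the difference quotient of
  \<open>1 - exp (- w)\<close> at 0, whose limit is 1.\<close>

lemma scaled_one_minus_exp_limit:
  fixes z :: complex
  shows "(\<lambda>n. of_nat n * (1 - exp (- (z / of_nat n)))) \<longlonglongrightarrow> z"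
proof (cases "z = 0")
  case False
  have "((\<lambda>w::complex. (1 - exp (- w)) / w) \<longlongrightarrow> 1) (at 0)"
  proof -
    have "((\<lambda>w::complex. 1 - exp (- w)) has_field_derivative 1) (at 0)"
      by (auto intro!: derivative_eq_intros)
    then show ?thesis by (simp add: has_field_derivative_iff)
  qed
  moreover have "filterlim (\<lambda>n. z / of_nat n) (at 0) sequentially"
    unfolding filterlim_at using False eventually_gt_at_top[of 0]
    by (auto intro!: lim_const_over_n elim!: eventually_mono)
  ultimately have "(\<lambda>n. (1 - exp (- (z / of_nat n))) / (z / of_nat n)) \<longlonglongrightarrow> 1"
    by (rule filterlim_compose)
  then have "(\<lambda>n. z * ((1 - exp (- (z / of_nat n))) / (z / of_nat n))) \<longlonglongrightarrow> z * 1"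
    by (intro tendsto_intros)
  moreover have "z * ((1 - exp (- (z / of_nat n))) / (z / of_nat n)) = of_nat n * (1 - exp (- (z / of_nat n)))" for n
    using False by simp
  ultimately show ?thesis by simp
qed simp

text \<open>Continuity and \<open>\<psi> 0 = 0\<close> select the branch of the negative logarithm:
  \<open>exp (- \<psi> t)\<close> alone determines \<open>\<psi> t\<close> only modulo multiples of
  2 pi i, and the transform need not have that period.\<close>

theorem theorem2p1:
  fixes M :: "real measure" and f :: "real \<Rightarrow> complex"
  assumes "real_distribution M"
    and "AE u in M. 0 \<le> u"
    and "characteristic_function f"
  shows "phi_ID (laplace_transform M) f \<longleftrightarrow>
    (\<exists>\<psi> :: real \<Rightarrow> complex.
       continuous_on UNIV \<psi> \<and> \<psi> 0 = 0 \<and>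
       infinitely_divisible_cf (\<lambda>t. exp (- \<psi> t)) \<and>
       (\<forall>t. f t = laplace_transform M (\<psi> t)))"
proof -
  interpret nonneg_distribution M
    using assms by (simp add: nonneg_distribution_def nonneg_distribution_axioms_def)
  show ?thesis
  proof
    assume "phi_ID (laplace_transform M) f"
    then obtain a g where a0: "\<And>n. n \<ge> 1 \<Longrightarrow> 0 < a n"
      and g0: "\<And>n. n \<ge> 1 \<Longrightarrow> characteristic_function (g n)"
      and lim0: "\<And>t. (\<lambda>n. laplace_transform M (of_real (a n) * (1 - g n t))) \<longlonglongrightarrow> f t"
      unfolding phi_ID_def by metis
    show "\<exists>\<psi>. continuous_on UNIV \<psi> \<and> \<psi> 0 = 0 \<and> infinitely_divisible_cf (\<lambda>t. exp (- \<psi> t)) \<and>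
        (\<forall>t. f t = laplace_transform M (\<psi> t))"
    proof (cases "AE u in M. u = 0")
      \<comment> \<open>Here the transform is identically 1 and gives no control of the exponents,
        but \<open>f\<close> is identically 1 as well, so \<open>\<psi> = 0\<close> serves as
        witness.\<close>
      case True
      have "laplace_transform M s = 1" for s
      proof -
        have "laplace_transform M s = (\<integral>u. 1 \<partial>M)"
          unfolding laplace_transform_def using True by (intro integral_cong_AE) auto
        then show ?thesis by (simp add: prob_space[unfolded space_eq_univ])
      qed
      moreover from this have "f t = 1" for t
        using lim0[of t] by (simp add: LIMSEQ_const_iff)
      ultimately show ?thesis
        by (intro exI[of _ "\<lambda>_. 0"])
          (auto simp: infinitely_divisible_cf_def cf_one intro!: exI[of _ "\<lambda>_. 1"])
    next
      case False
      \<comment> \<open>The hypotheses on \<open>a\<close> and \<open>g\<close> start at index 1,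
        hence the successor.\<close>
      define h where "h n t = of_real (a (Suc n)) * (1 - g (Suc n) t)" for n t
      have a: "0 \<le> a (Suc n)" and g: "characteristic_function (g (Suc n))" for n
        using a0[of "Suc n"] g0[of "Suc n"] by auto
      have cf_h: "characteristic_function (\<lambda>t. exp (- (h n t * of_real c)))" if "0 \<le> c" for n c
        unfolding h_def by (intro cf_exponent_scale g a that)
      have Re_h: "0 \<le> Re (h n t)" for n t
        using a cf_bounds(2)[OF g, of n t] complex_Re_le_cmod[of "g (Suc n) t"] by (simp add: h_def)
      have h0: "h n 0 = 0" for n
        using cf_bounds(1)[OF g] by (simp add: h_def)
      have cont_h: "continuous_on UNIV (h n)" for n
        unfolding h_def using cf_bounds(3)[OF g]
        by (intro continuous_intros) (auto simp: continuous_on_eq_continuous_at)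
      have lim: "(\<lambda>n. laplace_transform M (h n t)) \<longlonglongrightarrow> f t" for t
        using LIMSEQ_Suc[OF lim0] by (simp add: h_def)
      have "\<exists>\<delta>>0. \<exists>N. \<forall>n\<ge>N. \<forall>t. \<bar>t\<bar> \<le> \<delta> \<longrightarrow> norm (h n t) < r" if "0 < r" for r
        using cf_h cont_h Re_h h0 assms(3) lim False that by (rule exponents_equicontinuous_at_0)
      then obtain k \<psi> where k: "strict_mono (k :: nat \<Rightarrow> nat)"
        and \<psi>: "\<And>t. (\<lambda>n. h (k n) t) \<longlonglongrightarrow> \<psi> t" "continuous_on UNIV \<psi>"
        unfolding h_def using Poisson_exponents_convergent_subsequence[of "\<lambda>n. g (Suc n)" "\<lambda>n. a (Suc n)", OF g a] by blast
      have "\<psi> 0 = 0" using \<psi>(1)[of 0] by (simp add: h0 LIMSEQ_const_iff)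
      \<comment> \<open>All real \<open>c \<ge> 0\<close> are treated at once: \<open>c = 1\<close>
        gives the law itself and \<open>c = 1 / n\<close> its \<open>n\<close>-th root.\<close>
      have cf_\<psi>: "characteristic_function (\<lambda>t. exp (- (\<psi> t * of_real c)))" if "0 \<le> c" for c
      proof (rule cf_limit)
        show "characteristic_function (\<lambda>t. exp (- (h (k n) t * of_real c)))" for n
          by (rule cf_h[OF that])
        show "(\<lambda>n. exp (- (h (k n) t * of_real c))) \<longlonglongrightarrow> exp (- (\<psi> t * of_real c))" for t
          by (intro tendsto_intros \<psi>)
        have "continuous_on UNIV (\<lambda>t. exp (- (\<psi> t * of_real c)))"
          by (intro continuous_intros \<psi>)
        then show "isCont (\<lambda>t. exp (- (\<psi> t * of_real c))) 0"
          and "(\<lambda>t. exp (- (\<psi> t * of_real c))) \<in> borel_measurable borel"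
          by (auto simp: continuous_on_eq_continuous_at intro: borel_measurable_continuous_onI)
      qed
      have root: "exp (- \<psi> t) = exp (- (\<psi> t * of_real (1 / real n))) ^ n" if "1 \<le> n" for n t
        using that by (simp flip: exp_of_nat_mult)
      have "infinitely_divisible_cf (\<lambda>t. exp (- \<psi> t))"
        unfolding infinitely_divisible_cf_def
      proof (intro conjI allI impI)
        show "characteristic_function (\<lambda>t. exp (- \<psi> t))" using cf_\<psi>[of 1] by simp
        fix n :: nat assume "1 \<le> n"
        then show "\<exists>g. characteristic_function g \<and> (\<forall>t. exp (- \<psi> t) = g t ^ n)"
          using root cf_\<psi>[of "1 / real n"] by (intro exI[of _ "\<lambda>t. exp (- (\<psi> t * of_real (1 / real n)))"]) simp
      qed
      moreover have "f t = laplace_transform M (\<psi> t)" for t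
        using LIMSEQ_subseq_LIMSEQ[OF lim k] laplace_transform_tendsto[OF \<psi>(1) Re_h]
        by (intro LIMSEQ_unique[of "\<lambda>n. laplace_transform M (h (k n) t)"]) (auto simp: o_def)
      ultimately show ?thesis using \<psi>(2) \<open>\<psi> 0 = 0\<close> by blast
    qed
  next
    assume "\<exists>\<psi>. continuous_on UNIV \<psi> \<and> \<psi> 0 = 0 \<and> infinitely_divisible_cf (\<lambda>t. exp (- \<psi> t)) \<and>
        (\<forall>t. f t = laplace_transform M (\<psi> t))"
    then obtain \<psi> where \<psi>: "continuous_on UNIV \<psi>" "\<psi> 0 = 0" "infinitely_divisible_cf (\<lambda>t. exp (- \<psi> t))"
        "\<And>t. f t = laplace_transform M (\<psi> t)"
      by blast
    then obtain g where g: "\<And>n. n \<ge> 1 \<Longrightarrow> characteristic_function (g n)"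
        "\<And>n t. n \<ge> 1 \<Longrightarrow> exp (- \<psi> t) = g n t ^ n"
      unfolding infinitely_divisible_cf_def by metis
    have g_eq: "g (Suc n) t = exp (- (\<psi> t / of_nat (Suc n)))" for n t
      by (rule cf_nth_root_eq_exp[OF g(1) g(2) _ \<psi>(1,2)]) auto
    \<comment> \<open>The witnesses are \<open>a n = n\<close> and the \<open>n\<close>-th roots
      \<open>g n\<close>. Nothing is known about \<open>g 0\<close>, so the limit is computed along
      successors.\<close>
    have "(\<lambda>n. laplace_transform M (of_real (real n) * (1 - g n t))) \<longlonglongrightarrow> f t" for t
    proof (rule LIMSEQ_imp_Suc)
      have "(\<lambda>n. of_real (real (Suc n)) * (1 - g (Suc n) t)) \<longlonglongrightarrow> \<psi> t"
        using LIMSEQ_Suc[OF scaled_one_minus_exp_limit[of "\<psi> t"]] by (simp add: g_eq)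
      moreover have "0 \<le> Re (of_real (real (Suc n)) * (1 - g (Suc n) t))" for n
        using cf_Re_le_1[OF g(1)[of "Suc n"], of t] by (simp del: of_nat_Suc)
      ultimately show "(\<lambda>n. laplace_transform M (of_real (real (Suc n)) * (1 - g (Suc n) t))) \<longlonglongrightarrow> f t"
        unfolding \<psi>(4) by (rule laplace_transform_tendsto)
    qed
    then show "phi_ID (laplace_transform M) f"
      unfolding phi_ID_def using assms(3) g(1) by (intro conjI exI[of _ real] exI[of _ g]) auto
  qed
qed

end
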